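(* Let $\mathcal X$ be a separable Radon--Riesz space over $\mathbb F$ with $\dim\mathcal X>1$, and let $T$ be a power bounded bounded linear operator on $\mathcal X$ which is weakly l-sequentially supercyclic but not supercyclic. Let $y$ be any weakly l-sequentially supercyclic vector for $T$, so that for every $x\in\mathcal X\setminus\mathcal O_T([y])$ there exists a sequence of scalars $\{\alpha_k(x)\}_{k\ge0}$ for which $\alpha_k(x)T^{n_k(x)}y\to x$ weakly for some subsequence $\{T^{n_k(x)}\}_{k\ge0}$ of $\{T^n\}_{n\ge0}$. If such a sequence $\{\alpha_k(x)\}_{k\ge0}$ is bounded for each $x\in\mathcal X\setminus\mathcal O_T([y])$, then for every nonzero $f\in\mathcal X^*$ $$\limsup_j|f(T^{n_j}y)|<\|f\|\,\limsup_j\|T^{n_j}y\|$$ for some subsequence $\{T^{n_j}\}_{j\ge0}$ of $\{T^n\}_{n\ge0}$.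
   Context: $\mathbb F$ is $\mathbb R$ or $\mathbb C$; $\mathcal X^*$ is the (topological) dual of $\mathcal X$. A Radon--Riesz space is a normed space $\mathcal X$ such that, for every $\mathcal X$-valued sequence $\{x_n\}$ and every $x\in\mathcal X$: $x_n\to x$ in norm if and only if $x_n\to x$ weakly and $\|x_n\|\to\|x\|$. A bounded linear operator $T:\mathcal X\to\mathcal X$ is power bounded if $\sup_{n\ge0}\|T^n\|<\infty$. The projective orbit of a nonzero vector $y$ under $T$ is $\mathcal O_T([y])=\{\alpha T^ny:\alpha\in\mathbb F,\ n\ge0 \text{ an integer}\}$. $T$ is supercyclic if $\mathcal O_T([y])$ is norm dense in $\mathcal X$ for some $y\in\mathcal X$. The weak limit set $A^{-wl}$ of $A\subseteq\mathcal X$ is the set of all weak limits of weakly convergent $A$-valued sequences. A nonzero $y\in\mathcal X$ is a weakly l-sequentially supercyclic vector for $T$ if $\mathcal O_T([y])^{-wl}=\mathcal X$, and $T$ is weakly l-sequentially supercyclic if it has such a vector. Subsequences of $\{T^n\}_{n\ge0}$ correspond to strictly increasing sequences of exponents. *)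

theory Defs
  imports "HOL-Analysis.Analysis"
begin

(* The scalar field F, "R or C": a type isomorphic, as a normed real algebra, to real or to
   complex. The vector space structure over F is an explicit operation smul, on a type that
   already carries the norm and the underlying real structure. *)

class real_or_complex = real_normed_field +
  assumes real_or_complex:
    "(\<exists>\<phi>::'a \<Rightarrow> real. bij \<phi> \<and> \<phi> 1 = 1 \<and> (\<forall>a b. \<phi> (a + b) = \<phi> a + \<phi> b) \<and>
        (\<forall>a b. \<phi> (a * b) = \<phi> a * \<phi> b) \<and> (\<forall>r a. \<phi> (r *\<^sub>R a) = r *\<^sub>R \<phi> a) \<and>
        (\<forall>a. norm (\<phi> a) = norm a)) \<or>
     (\<exists>\<phi>::'a \<Rightarrow> complex. bij \<phi> \<and> \<phi> 1 = 1 \<and> (\<forall>a b. \<phi> (a + b) = \<phi> a + \<phi> b) \<and>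
        (\<forall>a b. \<phi> (a * b) = \<phi> a * \<phi> b) \<and> (\<forall>r a. \<phi> (r *\<^sub>R a) = r *\<^sub>R \<phi> a) \<and>
        (\<forall>a. norm (\<phi> a) = norm a))"

instance real :: real_or_complex
  by standard (rule disjI1, rule exI[of _ "\<lambda>x. x"], auto simp: bij_def)

instance complex :: real_or_complex
  by standard (rule disjI2, rule exI[of _ "\<lambda>x. x"], auto simp: bij_def)

locale normed_space = vector_space smul
  for smul :: "'k::real_or_complex \<Rightarrow> 'a::real_normed_vector \<Rightarrow> 'a" +
  assumes scale_of_real: "smul (of_real r) x = r *\<^sub>R x"
    and norm_scale: "norm (smul c x) = norm c * norm x"

lemma normed_space_scaleR: "normed_space ((*\<^sub>R) :: real \<Rightarrow> 'a::real_normed_vector \<Rightarrow> 'a)"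
  by unfold_locales (auto simp: algebra_simps)

lemma normed_space_mult: "normed_space ((*) :: 'k::real_or_complex \<Rightarrow> 'k \<Rightarrow> 'k)"
  by unfold_locales (auto simp: algebra_simps norm_mult scaleR_conv_of_real)

(* vector_space.dim is 0 on infinite-dimensional spaces, so it cannot express dim > 1. *)
definition dim_gt_1 :: "('k::field \<Rightarrow> 'a::ab_group_add \<Rightarrow> 'a) \<Rightarrow> bool" where
  "dim_gt_1 smul \<longleftrightarrow>
     (\<exists>B. \<not> module.dependent smul B \<and> module.span smul B = UNIV \<and> (infinite B \<or> card B > 1))"

definition dual_space :: "('k::real_or_complex \<Rightarrow> 'a::real_normed_vector \<Rightarrow> 'a) \<Rightarrow> ('a \<Rightarrow> 'k) set" where
  "dual_space smul = {f. Vector_Spaces.linear smul (*) f \<and> bounded_linear f}"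

definition bounded_operator :: "('k::real_or_complex \<Rightarrow> 'a::real_normed_vector \<Rightarrow> 'a) \<Rightarrow> ('a \<Rightarrow> 'a) \<Rightarrow> bool" where
  "bounded_operator smul T \<longleftrightarrow> Vector_Spaces.linear smul smul T \<and> bounded_linear T"

definition power_bounded :: "('a::real_normed_vector \<Rightarrow> 'a) \<Rightarrow> bool" where
  "power_bounded T \<longleftrightarrow> bdd_above (range (\<lambda>n. onorm (T ^^ n)))"

definition weakly_tendsto ::
  "('k::real_or_complex \<Rightarrow> 'a::real_normed_vector \<Rightarrow> 'a) \<Rightarrow> (nat \<Rightarrow> 'a) \<Rightarrow> 'a \<Rightarrow> bool" where
  "weakly_tendsto smul u x \<longleftrightarrow> (\<forall>f\<in>dual_space smul. (\<lambda>n. f (u n)) \<longlonglongrightarrow> f x)"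

definition radon_riesz :: "('k::real_or_complex \<Rightarrow> 'a::real_normed_vector \<Rightarrow> 'a) \<Rightarrow> bool" where
  "radon_riesz smul \<longleftrightarrow>
     (\<forall>u x. u \<longlonglongrightarrow> x \<longleftrightarrow> weakly_tendsto smul u x \<and> (\<lambda>n. norm (u n)) \<longlonglongrightarrow> norm x)"

definition projective_orbit :: "('k \<Rightarrow> 'a \<Rightarrow> 'a) \<Rightarrow> ('a \<Rightarrow> 'a) \<Rightarrow> 'a \<Rightarrow> 'a set" where
  "projective_orbit smul T y = {smul \<alpha> ((T ^^ n) y) |\<alpha> n. True}"

definition supercyclic :: "('k::real_or_complex \<Rightarrow> 'a::real_normed_vector \<Rightarrow> 'a) \<Rightarrow> ('a \<Rightarrow> 'a) \<Rightarrow> bool" where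
  "supercyclic smul T \<longleftrightarrow> (\<exists>y. y \<noteq> 0 \<and> closure (projective_orbit smul T y) = UNIV)"

definition weak_limit_set :: "('k::real_or_complex \<Rightarrow> 'a::real_normed_vector \<Rightarrow> 'a) \<Rightarrow> 'a set \<Rightarrow> 'a set" where
  "weak_limit_set smul A = {x. \<exists>u. (\<forall>n. u n \<in> A) \<and> weakly_tendsto smul u x}"

definition weakly_l_seq_supercyclic_vector ::
  "('k::real_or_complex \<Rightarrow> 'a::real_normed_vector \<Rightarrow> 'a) \<Rightarrow> ('a \<Rightarrow> 'a) \<Rightarrow> 'a \<Rightarrow> bool" where
  "weakly_l_seq_supercyclic_vector smul T y \<longleftrightarrow>
     y \<noteq> 0 \<and> weak_limit_set smul (projective_orbit smul T y) = UNIV"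

definition weakly_l_seq_supercyclic ::
  "('k::real_or_complex \<Rightarrow> 'a::real_normed_vector \<Rightarrow> 'a) \<Rightarrow> ('a \<Rightarrow> 'a) \<Rightarrow> bool" where
  "weakly_l_seq_supercyclic smul T \<longleftrightarrow> (\<exists>y. weakly_l_seq_supercyclic_vector smul T y)"

end

theory Submission
  imports Defs
begin

text \<open>
  If the conclusion fails for \<open>f\<close>, then \<open>\<parallel>f\<parallel> \<parallel>T\<^sup>n y\<parallel> - |f (T\<^sup>n y)|\<close> tends to \<open>0\<close>. When
  \<open>v\<^sub>k = \<alpha>\<^sub>k T\<^sup>n\<^sup>k y\<close> tends weakly to \<open>x\<close> with \<open>\<alpha>\<close> bounded, it follows that \<open>\<parallel>f\<parallel> \<parallel>v\<^sub>k\<parallel>\<close> tends to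
  \<open>|f x| \<le> \<parallel>f\<parallel> \<parallel>x\<parallel>\<close>, so the Radon--Riesz property makes the convergence strong, and \<open>T\<close> is
  supercyclic.
\<close>

text \<open>
  Weak lower semicontinuity of the norm would make \<open>c = \<parallel>x\<parallel>\<close>, but it rests on the Hahn--Banach
  theorem. The Radon--Riesz property replaces it: if \<open>c < \<parallel>x\<parallel>\<close>, the points
  \<open>x + s\<^sub>k (v\<^sub>k - x)\<close> have norm exactly \<open>\<parallel>x\<parallel>\<close> for suitable bounded \<open>s\<^sub>k \<ge> 1\<close>.
\<close>

lemma radon_riesz_tendsto:
  fixes smul :: "'k::real_or_complex \<Rightarrow> 'a::real_normed_vector \<Rightarrow> 'a"
  assumes RR: "radon_riesz smul" and weak: "weakly_tendsto smul v x"
    and lim: "(\<lambda>k. norm (v k)) \<longlonglongrightarrow> c" and le: "c \<le> norm x"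
  shows "v \<longlonglongrightarrow> x"
proof (cases "c = norm x")
  case True
  then show ?thesis using RR weak lim unfolding radon_riesz_def by blast
next
  case False
  \<comment> \<open>\<open>norm x - d\<close> is the midpoint of \<open>c\<close> and
    \<open>norm x\<close>. So \<open>norm (v k)\<close> is eventually below it, which keeps
    \<open>v k\<close> at distance at least \<open>d\<close> from \<open>x\<close>.\<close>
  define d where "d = (norm x - c) / 2"
  have c0: "c \<ge> 0" using lim by (rule LIMSEQ_le_const) auto
  have d0: "d > 0" using False le by (simp add: d_def)
  have dx: "d \<le> norm x" using c0 d0 by (simp add: d_def)
  \<comment> \<open>Chosen so that \<open>S * d - norm x = norm x\<close>: stretching
    \<open>v k - x\<close> by \<open>S\<close> reaches norm at least \<open>norm x\<close>, while
    the factor 1 gives \<open>v k\<close> itself, which is too short.\<close>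
  define S where "S = 2 * norm x / d"
  have S1: "1 \<le> S" using d0 dx by (simp add: S_def field_simps)
  have "\<exists>s. 1 \<le> s \<and> s \<le> S \<and> norm (x + s *\<^sub>R (v k - x)) = norm x"
    if k: "norm (v k) < norm x - d" for k
  proof (rule IVT[where f = "\<lambda>s. norm (x + s *\<^sub>R (v k - x))"])
    show "norm (x + 1 *\<^sub>R (v k - x)) \<le> norm x" using k d0 by simp
    have "d \<le> norm (v k - x)" using k norm_triangle_ineq2[of x "v k"] by (simp add: norm_minus_commute)
    then have "S * d \<le> S * norm (v k - x)" using S1 by (intro mult_left_mono) auto
    also have "\<dots> = norm (S *\<^sub>R (v k - x))" using S1 by simp
    also have "\<dots> \<le> norm (x + S *\<^sub>R (v k - x)) + norm x"
      using norm_triangle_ineq4[of "x + S *\<^sub>R (v k - x)" x] by simp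
    finally show "norm x \<le> norm (x + S *\<^sub>R (v k - x))" using d0 by (simp add: S_def)
  qed (use S1 in \<open>auto intro!: continuous_intros\<close>)
  \<comment> \<open>At the finitely many other indices \<open>s k\<close> is arbitrary, so the
    estimates below are only claimed eventually.\<close>
  then obtain s where s: "\<And>k. norm (v k) < norm x - d \<Longrightarrow>
      1 \<le> s k \<and> s k \<le> S \<and> norm (x + s k *\<^sub>R (v k - x)) = norm x"
    by metis
  have ev: "\<forall>\<^sub>F k in sequentially. norm (v k) < norm x - d"
    using order_tendstoD(2)[OF lim, of "norm x - d"] False le by (simp add: d_def field_simps)
  define w where "w k = x + s k *\<^sub>R (v k - x)" for k
  have "weakly_tendsto smul w x"
    unfolding weakly_tendsto_def
  proof
    fix g assume g: "g \<in> dual_space smul"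
    then interpret g: bounded_linear g by (simp add: dual_space_def)
    have "(\<lambda>k. g (v k) - g x) \<longlonglongrightarrow> 0"
      using weak g by (simp add: weakly_tendsto_def LIM_zero)
    \<comment> \<open>The upper bound \<open>S\<close> on the factors preserves weak
      convergence.\<close>
    then have "(\<lambda>k. s k *\<^sub>R (g (v k) - g x)) \<longlonglongrightarrow> 0"
    proof (rule tendsto_0_le[where K = S])
      show "\<forall>\<^sub>F k in sequentially. norm (s k *\<^sub>R (g (v k) - g x)) \<le> norm (g (v k) - g x) * S"
        using ev by eventually_elim (use s in \<open>force simp: mult.commute intro: mult_right_mono\<close>)
    qed
    from tendsto_add[OF tendsto_const[of "g x"] this] show "(\<lambda>k. g (w k)) \<longlonglongrightarrow> g x"
      by (simp add: w_def g.add g.scaleR g.diff)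
  qed
  moreover have "(\<lambda>k. norm (w k)) \<longlonglongrightarrow> norm x"
    by (rule tendsto_eventually) (use ev s in \<open>auto simp: w_def elim: eventually_mono\<close>)
  ultimately have "w \<longlonglongrightarrow> x" using RR unfolding radon_riesz_def by blast
  then have "(\<lambda>k. w k - x) \<longlonglongrightarrow> 0" by (rule LIM_zero)
  \<comment> \<open>Here the lower bound 1 on the factors enters: \<open>v k\<close> is no farther
    from \<open>x\<close> than \<open>w k\<close>.\<close>
  then have "(\<lambda>k. v k - x) \<longlonglongrightarrow> 0"
  proof (rule tendsto_0_le[where K = 1])
    show "\<forall>\<^sub>F k in sequentially. norm (v k - x) \<le> norm (w k - x) * 1"
      using ev
    proof eventually_elim
      case (elim k)
      then have "1 * norm (v k - x) \<le> \<bar>s k\<bar> * norm (v k - x)"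
        using s[of k] by (intro mult_right_mono) auto
      then show ?case by (simp add: w_def)
    qed
  qed
  then show ?thesis by (rule LIM_zero_cancel)
qed

text \<open>Otherwise the defect stays above some \<open>e > 0\<close> along a subsequence. By
  boundedness it can be refined so that \<open>norm (u n)\<close> converges to a finite
  \<open>L\<close>, and the assumed inequality becomes
  \<open>onorm f * L \<le> onorm f * L - e\<close>.\<close>

lemma defect_tendsto_zero:
  fixes u :: "nat \<Rightarrow> 'a::real_normed_vector" and f :: "'a \<Rightarrow> 'b::real_normed_vector"
  assumes f: "bounded_linear f" and u: "bounded (range u)"
    and limsup_ge: "\<And>n :: nat \<Rightarrow> nat. strict_mono n \<Longrightarrow>
      ereal (onorm f) * limsup (\<lambda>j. ereal (norm (u (n j)))) \<le> limsup (\<lambda>j. ereal (norm (f (u (n j)))))"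
  shows "(\<lambda>n. onorm f * norm (u n) - norm (f (u n))) \<longlonglongrightarrow> 0"
proof (rule ccontr)
  let ?d = "\<lambda>n. onorm f * norm (u n) - norm (f (u n))"
  have nonneg: "0 \<le> ?d n" for n using onorm[OF f] by simp
  assume "\<not> ?d \<longlonglongrightarrow> 0"
  then obtain e where e: "e > 0" and "\<forall>N. \<exists>n\<ge>N. \<not> dist (?d n) 0 < e"
    unfolding lim_sequentially by blast
  moreover have "dist (?d n) 0 = ?d n" for n
    using nonneg[of n] by (simp only: dist_real_def abs_of_nonneg diff_0_right)
  ultimately have freq: "\<forall>N. \<exists>n\<ge>N. e \<le> ?d n" by (simp only: not_less simp_thms)
  have "infinite {n. e \<le> ?d n}" unfolding infinite_nat_iff_unbounded_le using freq by blast
  then obtain r :: "nat \<Rightarrow> nat" where r: "strict_mono r" "\<And>k. e \<le> ?d (r k)"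
    using infinite_enumerate[of "{n. e \<le> ?d n}"] by blast
  have "bounded (range (\<lambda>k. norm (u (r k))))"
    using u by (auto simp: bounded_iff)
  then obtain L q where q: "strict_mono q" "(\<lambda>k. norm (u (r (q k)))) \<longlonglongrightarrow> L"
    using bounded_imp_convergent_subsequence[of "\<lambda>k. norm (u (r k))"] unfolding o_def by blast
  let ?n = "r \<circ> q"
  have "limsup (\<lambda>j. ereal (norm (u (?n j)))) = ereal L"
    using q by (intro lim_imp_Limsup) (auto simp: o_def)
  moreover have "strict_mono ?n" using r q by (simp add: strict_mono_o)
  ultimately have "ereal (onorm f) * ereal L \<le> limsup (\<lambda>j. ereal (norm (f (u (?n j)))))"
    using limsup_ge[of ?n] by (simp only:)
  also have "\<dots> \<le> limsup (\<lambda>j. ereal (onorm f * norm (u (?n j)) - e))"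
  proof (intro Limsup_mono always_eventually allI)
    show "ereal (norm (f (u (?n j)))) \<le> ereal (onorm f * norm (u (?n j)) - e)" for j
      using r(2)[of "q j"] by simp
  qed
  also have "\<dots> = ereal (onorm f * L - e)"
    using q by (intro lim_imp_Limsup) (auto simp: o_def intro!: tendsto_intros)
  finally show False using e by simp
qed

lemma bounded_linear_funpow:
  fixes T :: "'a::real_normed_vector \<Rightarrow> 'a"
  shows "bounded_linear T \<Longrightarrow> bounded_linear (T ^^ n)"
  by (induction n) (auto simp: id_def comp_def intro: bounded_linear_ident bounded_linear_compose)

lemma power_bounded_orbit_bounded:
  assumes "bounded_linear T" and "power_bounded T"
  shows "bounded (range (\<lambda>n. (T ^^ n) y))"
proof -
  obtain M where M: "\<And>n. onorm (T ^^ n) \<le> M"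
    using assms(2) by (auto simp: power_bounded_def bdd_above_def)
  have "norm ((T ^^ n) y) \<le> M * norm y" for n
    using onorm[OF bounded_linear_funpow[OF assms(1)], of n y] mult_right_mono[OF M[of n], of "norm y"]
    by simp
  then show ?thesis by (auto simp: bounded_iff)
qed

theorem corollary5p2:
  fixes smul :: "'k::real_or_complex \<Rightarrow> 'a::real_normed_vector \<Rightarrow> 'a"
    and T :: "'a \<Rightarrow> 'a" and y :: 'a
  assumes "normed_space smul"
    and "separable_space (euclidean :: 'a topology)"
    and "radon_riesz smul"
    and "dim_gt_1 smul"
    and "bounded_operator smul T"
    and "power_bounded T"
    and "weakly_l_seq_supercyclic smul T"
    and "\<not> supercyclic smul T"
    and "weakly_l_seq_supercyclic_vector smul T y"
    and "\<And>x. x \<notin> projective_orbit smul T y \<Longrightarrow>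
           \<exists>(\<alpha> :: nat \<Rightarrow> 'k) (n :: nat \<Rightarrow> nat). strict_mono n \<and>
             weakly_tendsto smul (\<lambda>k. smul (\<alpha> k) ((T ^^ n k) y)) x \<and> bounded (range \<alpha>)"
  shows "\<forall>f\<in>dual_space smul. f \<noteq> (\<lambda>x. 0) \<longrightarrow>
           (\<exists>n :: nat \<Rightarrow> nat. strict_mono n \<and>
             limsup (\<lambda>j. ereal (norm (f ((T ^^ n j) y)))) <
               ereal (onorm f) * limsup (\<lambda>j. ereal (norm ((T ^^ n j) y))))"
proof (intro ballI impI, rule ccontr)
  interpret normed_space smul by fact
  fix f assume f: "f \<in> dual_space smul" and f0: "f \<noteq> (\<lambda>x. 0)"
  assume neg: "\<nexists>n :: nat \<Rightarrow> nat. strict_mono n \<and>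
             limsup (\<lambda>j. ereal (norm (f ((T ^^ n j) y)))) <
               ereal (onorm f) * limsup (\<lambda>j. ereal (norm ((T ^^ n j) y)))"
  have bl: "bounded_linear f" and lin: "Vector_Spaces.linear smul (*) f"
    using f by (auto simp: dual_space_def)
  interpret F: Vector_Spaces.linear smul "(*)" f by fact
  have pos: "0 < onorm f" using f0 by (auto simp: onorm_pos_lt[OF bl])
  define u where "u n = (T ^^ n) y" for n
  \<comment> \<open>The negated conclusion, read for every strictly increasing \<open>n\<close>, is
    the limsup hypothesis of the lemma.\<close>
  have defect: "(\<lambda>n. onorm f * norm (u n) - norm (f (u n))) \<longlonglongrightarrow> 0"
  proof (rule defect_tendsto_zero[OF bl])
    show "bounded (range u)"
      unfolding u_def using assms(5,6) by (intro power_bounded_orbit_bounded) (auto simp: bounded_operator_def)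
  qed (use neg in \<open>auto simp: u_def not_less\<close>)
  have "x \<in> closure (projective_orbit smul T y)" for x
  proof (cases "x \<in> projective_orbit smul T y")
    case True
    then show ?thesis using closure_subset by blast
  next
    case False
    from assms(10)[OF this] obtain \<alpha> :: "nat \<Rightarrow> 'k" and n
      where n: "strict_mono n" and weak: "weakly_tendsto smul (\<lambda>k. smul (\<alpha> k) (u (n k))) x"
        and \<alpha>: "bounded (range \<alpha>)"
      unfolding u_def by blast
    define v where "v k = smul (\<alpha> k) (u (n k))" for k
    obtain K where K: "\<And>k. norm (\<alpha> k) \<le> K" using \<alpha> by (auto simp: bounded_iff)
    have fv: "norm (f (v k)) = norm (\<alpha> k) * norm (f (u (n k)))" for k
      by (simp add: v_def norm_mult F.scale)
    \<comment> \<open>The defect is homogeneous in the vector, so bounded scalars keep it tending to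
      0.\<close>
    have defect_v: "onorm f * norm (v k) - norm (f (v k)) =
        norm (\<alpha> k) * (onorm f * norm (u (n k)) - norm (f (u (n k))))" for k
      unfolding fv by (simp add: v_def norm_scale algebra_simps)
    have "(\<lambda>k. norm (f (v k))) \<longlonglongrightarrow> norm (f x)"
      using weak f unfolding weakly_tendsto_def v_def by (intro tendsto_norm) blast
    moreover have "(\<lambda>k. onorm f * norm (v k) - norm (f (v k))) \<longlonglongrightarrow> 0"
    proof (rule tendsto_0_le[OF LIMSEQ_subseq_LIMSEQ[OF defect n], where K = K])
      show "\<forall>\<^sub>F k in sequentially. norm (onorm f * norm (v k) - norm (f (v k))) \<le>
          norm (((\<lambda>n. onorm f * norm (u n) - norm (f (u n))) \<circ> n) k) * K"
        unfolding defect_v using K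
        by (intro always_eventually allI) (simp add: abs_mult mult.commute[of _ K] mult_right_mono)
    qed
    \<comment> \<open>Weak convergence gives the limit of \<open>norm (f (v k))\<close> only; the
      vanishing defect carries it over to the norms of the vectors themselves.\<close>
    ultimately have "(\<lambda>k. onorm f * norm (v k)) \<longlonglongrightarrow> norm (f x)"
      by (rule Lim_transform)
    from tendsto_divide[OF this tendsto_const[of "onorm f"]]
    have "(\<lambda>k. norm (v k)) \<longlonglongrightarrow> norm (f x) / onorm f"
      using pos by simp
    moreover have "norm (f x) / onorm f \<le> norm x"
      using onorm[OF bl, of x] pos by (simp add: field_simps)
    ultimately have "v \<longlonglongrightarrow> x"
      using radon_riesz_tendsto[OF assms(3)] weak unfolding v_def by blast
    moreover have "v k \<in> projective_orbit smul T y" for k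
      by (auto simp: v_def u_def projective_orbit_def)
    ultimately show ?thesis unfolding closure_sequential by blast
  qed
  moreover have "y \<noteq> 0" using assms(9) by (simp add: weakly_l_seq_supercyclic_vector_def)
  ultimately show False using assms(8) unfolding supercyclic_def by blast
qed

end
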